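(* If $T \in \mathscr{T}_{max}$ has $n = |V(T)| \ge 3$, then there is a leaf $v \in V(T)$ such that $T - v \in \mathscr{T}_{max}$.
   Context: A leaf is a vertex of degree 1. $N(v)$ denotes the open neighborhood of $v$. A set $S \subseteq V(G)$ is a locating-dominating (LD) set if for all $u,v \in V(G)-S$: $N(v)\cap S \neq \varnothing$, and if $u \ne v$ then $N(v) \cap S \neq N(u) \cap S$. A RED:LD set is an LD set $S$ such that $S-\{v\}$ is an LD set for every $v \in S$. $\textrm{RED:LD}(G)$ is the minimum cardinality of a RED:LD set of $G$. $\mathscr{T}_{max}$ is the family of all trees $T$ of order $n \ge 2$ with $\textrm{RED:LD}(T) = n$. *)

theory Defs
  imports "Graph_Theory.Graph_Theory"
begin

text \<open>
  Finite simple undirected graphs are finite, loop-free, symmetric digraphs without parallel arcs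
  (locale \<open>graph\<close>); an undirected edge is a pair of opposite arcs, so the degree of a vertex is its
  out-degree. The predicate \<open>tree\<close> of the imported theory cannot be used: its notion of cycle
  admits the closed walk of length 2 along an arc and its reverse, so no symmetric digraph with an
  arc satisfies it. Undirected cycles are the cycles of length at least 3.
\<close>

definition sgraph_tree :: "('a, 'b) pre_digraph \<Rightarrow> bool" where
  "sgraph_tree G \<longleftrightarrow>
     graph G \<and> connected G \<and> \<not> (\<exists>p. pre_digraph.cycle G p \<and> 3 \<le> length p)"

definition leaf :: "('a, 'b) pre_digraph \<Rightarrow> 'a \<Rightarrow> bool" where
  "leaf G v \<longleftrightarrow> v \<in> verts G \<and> out_degree G v = 1"

definition nbhd :: "('a, 'b) pre_digraph \<Rightarrow> 'a \<Rightarrow> 'a set" where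
  "nbhd G v = {u \<in> verts G. v \<rightarrow>\<^bsub>G\<^esub> u}"

definition LD_set :: "('a, 'b) pre_digraph \<Rightarrow> 'a set \<Rightarrow> bool" where
  "LD_set G S \<longleftrightarrow> S \<subseteq> verts G \<and>
     (\<forall>u \<in> verts G - S. \<forall>v \<in> verts G - S.
        nbhd G v \<inter> S \<noteq> {} \<and> (u \<noteq> v \<longrightarrow> nbhd G v \<inter> S \<noteq> nbhd G u \<inter> S))"

definition RED_LD_set :: "('a, 'b) pre_digraph \<Rightarrow> 'a set \<Rightarrow> bool" where
  "RED_LD_set G S \<longleftrightarrow> LD_set G S \<and> (\<forall>v \<in> S. LD_set G (S - {v}))"

text \<open>
  The minimum is over a nonempty set whenever \<open>G\<close> is finite without isolated vertices, since
  \<open>verts G\<close> is then a RED:LD set; this covers all trees of order at least 2.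
\<close>

definition RED_LD :: "('a, 'b) pre_digraph \<Rightarrow> nat" where
  "RED_LD G = (LEAST k. \<exists>S. RED_LD_set G S \<and> card S = k)"

definition T_max :: "('a, 'b) pre_digraph set" where
  "T_max = {T. sgraph_tree T \<and> 2 \<le> card (verts T) \<and> RED_LD T = card (verts T)}"

end

theory Submission
  imports Defs
begin

text \<open>
  Supersets of RED:LD sets are RED:LD, so \<open>RED_LD T\<close> equals the order of \<open>T\<close> iff no set
  \<open>verts T - {x}\<close> is RED:LD. Since two vertices of a tree have at most one common neighbour,
  \<open>verts T - {x}\<close> fails to be RED:LD exactly when \<open>x\<close> is a leaf or adjacent to a leaf.
  Hence \<open>T_max\<close> consists of the trees in which every vertex is a leaf or adjacent to one.

  In such a tree of order at least 3 take the second vertex \<open>x\<close> of a longest path and let \<open>v\<close> be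
  the leaf where that path starts. At most one neighbour of \<open>x\<close> is not a leaf, so in \<open>T - v\<close> the
  vertex \<open>x\<close> either is still adjacent to a leaf or has become a leaf itself; every other vertex
  keeps its status.
\<close>

section \<open>Neighbourhoods and leaves\<close>

lemma (in wf_digraph) in_nbhd_iff: "u \<in> nbhd G v \<longleftrightarrow> v \<rightarrow> u"
  by (auto simp: nbhd_def)

context graph
begin

lemma adj_sym: "u \<rightarrow> v \<longleftrightarrow> v \<rightarrow> u"
  using sym_arcs unfolding symmetric_def by (blast dest: symD)

lemma nbhd_sym: "u \<in> nbhd G v \<longleftrightarrow> v \<in> nbhd G u"
  by (simp add: in_nbhd_iff adj_sym)

lemma not_in_nbhd_self: "v \<notin> nbhd G v"
  using adj_not_same by (auto simp: in_nbhd_iff)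

lemma out_degree_eq_card_nbhd: "out_degree G v = card (nbhd G v)"
proof -
  have "inj_on (head G) (out_arcs G v)"
    by (auto simp: inj_on_def arc_to_ends_def intro!: no_multi_arcs)
  moreover have "head G ` out_arcs G v = nbhd G v"
    by (auto simp: nbhd_def arcs_ends_def arc_to_ends_def)
  ultimately show ?thesis
    unfolding out_degree_def by (metis card_image)
qed

lemma leaf_iff: "leaf G v \<longleftrightarrow> (\<exists>u. nbhd G v = {u})"
proof -
  have "v \<in> verts G" if "nbhd G v = {u}" for u
    using that in_nbhd_iff[of u v] by (auto dest: adj_in_verts)
  then show ?thesis
    by (auto simp: leaf_def out_degree_eq_card_nbhd card_1_singleton_iff)
qed

section \<open>Vertex deletion, connectedness, and trees without one leaf\<close>

lemma graph_del_vert: "graph (del_vert v)"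
proof -
  have "symmetric (del_vert v)"
    using sym_arcs
    unfolding symmetric_def sym_def arcs_ends_def
    by (fastforce simp: del_vert_simps arc_to_ends_def)
  then show ?thesis
    by unfold_locales (auto simp: del_vert_simps arc_to_ends_def no_loops intro: no_multi_arcs)
qed

lemma adj_del_vert_iff: "u \<rightarrow>\<^bsub>del_vert v\<^esub> w \<longleftrightarrow> u \<rightarrow> w \<and> u \<noteq> v \<and> w \<noteq> v"
  by (auto simp: arcs_ends_def del_vert_simps arc_to_ends_def)

lemma nbhd_del_vert: "u \<noteq> v \<Longrightarrow> nbhd (del_vert v) u = nbhd G u - {v}"
  by (auto simp: nbhd_def adj_del_vert_iff del_vert_simps)

text \<open>The library defines connectedness through the symmetric closure of the digraph; here the
  arcs are symmetric already, so reachability in the graph itself decides it.\<close>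

lemma connected_iff_reachable:
  "connected G \<longleftrightarrow> verts G \<noteq> {} \<and> (\<forall>u\<in>verts G. \<forall>v\<in>verts G. u \<rightarrow>\<^sup>* v)"
  using reachable_mk_symmetric_eq[OF sym_arcs]
  by (simp add: connected_def strongly_connected_def)

lemma connected_imp_nbhd_nonempty:
  assumes "connected G" "2 \<le> card (verts G)" "v \<in> verts G"
  shows "nbhd G v \<noteq> {}"
proof -
  have "\<not> verts G \<subseteq> {v}"
    using assms(2) card_mono[of "{v}" "verts G"] by auto
  then obtain w where w: "w \<in> verts G" "w \<noteq> v" by auto
  then have "v \<rightarrow>\<^sup>* w"
    using assms connected_iff_reachable by auto
  then obtain u where "v \<rightarrow> u"
    using w by (auto elim: converse_reachable_cases)
  then show ?thesis
    by (auto simp: in_nbhd_iff[symmetric])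
qed

lemma connected_del_leaf:
  assumes con: "connected G" and v: "nbhd G v = {x}"
  shows "connected (del_vert v)"
proof -
  interpret D: graph "del_vert v" by (rule graph_del_vert)
  have vx: "v \<rightarrow> u \<longleftrightarrow> u = x" for u
    using v by (simp add: in_nbhd_iff[symmetric])
  have "v \<rightarrow> x" by (simp add: vx)
  then have x: "x \<in> verts (del_vert v)"
    using adj_not_same by (auto simp: del_vert_simps)
  \<comment> \<open>A walk enters and leaves \<open>v\<close> only through \<open>x\<close>. Reading
    each visit to \<open>v\<close> as a stay at \<open>x\<close> turns the walk into one that avoids
    \<open>v\<close>, and makes the claim strong enough for induction along the walk.\<close>
  have reach: "u \<rightarrow>\<^sup>*\<^bsub>del_vert v\<^esub> (if w = v then x else w)"
    if "u \<rightarrow>\<^sup>* w" "u \<noteq> v" for u w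
    using that
  proof (induction rule: reachable_induct)
    case base
    then show ?case by (simp add: del_vert_simps)
  next
    case (step w w')
    then have IH: "u \<rightarrow>\<^sup>*\<^bsub>del_vert v\<^esub> (if w = v then x else w)" by blast
    consider "w = v" | "w' = v" "w \<noteq> v" | "w \<noteq> v" "w' \<noteq> v" by blast
    then show ?case
    proof cases
      case 1
      then show ?thesis using IH step.hyps vx \<open>v \<rightarrow> x\<close> adj_not_same by auto
    next
      case 2
      then show ?thesis using IH step.hyps vx adj_sym[of w v] by auto
    next
      case 3
      then have "w \<rightarrow>\<^bsub>del_vert v\<^esub> w'" using step adj_del_vert_iff by blast
      then show ?thesis using IH 3 D.reachable_adj_trans by auto
    qed
  qed
  show ?thesis
    unfolding D.connected_iff_reachable
  proof (intro conjI ballI)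
    show "verts (del_vert v) \<noteq> {}" using x by blast
    fix u w assume "u \<in> verts (del_vert v)" "w \<in> verts (del_vert v)"
    then show "u \<rightarrow>\<^sup>*\<^bsub>del_vert v\<^esub> w"
      using con reach[of u w] by (simp add: connected_iff_reachable del_vert_simps)
  qed
qed

lemma cycle_del_vertD:
  assumes "pre_digraph.cycle (del_vert v) p"
  shows "cycle p"
proof -
  interpret D: graph "del_vert v" by (rule graph_del_vert)
  obtain u where u: "D.awalk u p u" "distinct (tl (D.awalk_verts u p))" "p \<noteq> []"
    using assms unfolding D.cycle_def by blast
  have "awalk u p u"
    using subgraph_awalk_imp_awalk[OF u(1) subgraph_del_vert] .
  moreover have "D.awalk_verts u p = awalk_verts u p"
    by (induction p arbitrary: u) (auto simp: del_vert_simps)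
  ultimately show ?thesis
    using u unfolding cycle_def by metis
qed

end

lemma sgraph_tree_del_leaf:
  assumes T: "sgraph_tree T" and v: "leaf T v"
  shows "sgraph_tree (pre_digraph.del_vert T v)"
proof -
  interpret graph T using T by (simp add: sgraph_tree_def)
  obtain x where "nbhd T v = {x}" using v leaf_iff by blast
  then have "connected (del_vert v)"
    using T connected_del_leaf by (simp add: sgraph_tree_def)
  then show ?thesis
    using T graph_del_vert cycle_del_vertD unfolding sgraph_tree_def by blast
qed

section \<open>Paths in trees\<close>

text \<open>Cycles are lists of arcs, whereas paths are extended and cut as lists of vertices; this
  passes from the second view to the first.\<close>

lemma (in wf_digraph) vwalk_imp_awalk:
  assumes "vwalk p G"
  shows "\<exists>q. awalk (hd p) q (last p) \<and> awalk_verts (hd p) q = p"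
  using assms
proof (induction p rule: vwalk_induct)
  case (Base u)
  then show ?case by (intro exI[of _ "[]"]) (simp add: awalk_Nil_iff)
next
  case (Cons u v es)
  then obtain q e where "awalk v q (last (v # es))" "awalk_verts v q = v # es"
    "e \<in> arcs G" "tail G e = u" "head G e = v"
    by (auto simp: arcs_ends_def arc_to_ends_def)
  then show ?case
    by (intro exI[of _ "e # q"]) (auto simp: awalk_Cons_iff)
qed

lemma sgraph_tree_vpath_not_closed:
  assumes T: "sgraph_tree T" and p: "vpath p T" "3 \<le> length p"
  shows "\<not> last p \<rightarrow>\<^bsub>T\<^esub> hd p"
proof
  assume adj: "last p \<rightarrow>\<^bsub>T\<^esub> hd p"
  interpret graph T using T by (simp add: sgraph_tree_def)
  obtain q where q: "awalk (hd p) q (last p)" "awalk_verts (hd p) q = p"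
    using p vwalk_imp_awalk by (auto simp: vpath_def)
  obtain e where e: "awalk (last p) [e] (hd p)" "awalk_verts (last p) [e] = [last p, hd p]"
    using adj by (auto simp: arcs_ends_def arc_to_ends_def awalk_def)
  have c: "awalk (hd p) (q @ [e]) (hd p)"
    using q(1) e(1) by (rule awalk_appendI)
  have "awalk_verts (hd p) (q @ [e]) = p @ [hd p]"
    using awalk_verts_append[OF c] q e awlast_of_awalk by (cases p) auto
  \<comment> \<open>Dropping the first vertex leaves a rotation of \<open>p\<close>, which is
    repetition-free because \<open>p\<close> is a path.\<close>
  moreover have "distinct (tl (p @ [hd p]))"
    using p by (cases p) (auto simp: vpath_def)
  ultimately have "cycle (q @ [e])"
    using c unfolding cycle_def by (metis append_is_Nil_conv not_Cons_self2)
  \<comment> \<open>\<open>q\<close> has one arc fewer than \<open>p\<close> has vertices, and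
    \<open>e\<close> makes up for it, so the cycle is as long as \<open>p\<close>.\<close>
  moreover have "length (q @ [e]) \<ge> 3"
    using p q length_awalk_verts[of "hd p" q] by simp
  ultimately show False
    using T by (auto simp: sgraph_tree_def)
qed

text \<open>The segment from \<open>a\<close> through \<open>b\<close> to \<open>c\<close> has at
  least three vertices, so a chord from \<open>a\<close> to \<open>c\<close> would close it into a
  cycle.\<close>

lemma sgraph_tree_vpath_adj_hd:
  assumes T: "sgraph_tree T" and p: "vpath (a # b # ps) T" and c: "c \<in> set ps"
  shows "\<not> a \<rightarrow>\<^bsub>T\<^esub> c"
proof -
  interpret graph T using T by (simp add: sgraph_tree_def)
  obtain us ws where ps: "ps = us @ c # ws"
    using c by (auto simp: in_set_conv_decomp)
  have "vwalk (a # b # us @ [c]) T"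
    using p ps vwalkI_append_l[of "a # b # us @ [c]" ws T] by (auto simp: vpath_def)
  then have "vpath (a # b # us @ [c]) T"
    using p ps by (auto simp: vpath_def)
  from sgraph_tree_vpath_not_closed[OF T this] show ?thesis
    by (simp add: adj_sym)
qed

text \<open>A further neighbour of the end vertex would either lie on the path, giving a chord, or
  prolong the path.\<close>

lemma longest_vpath_hd_nbhd:
  assumes T: "sgraph_tree T" and p: "vpath (a # b # ps) T"
    and longest: "\<And>q. vpath q T \<Longrightarrow> length q \<le> length (a # b # ps)"
  shows "nbhd T a = {b}"
proof -
  interpret graph T using T by (simp add: sgraph_tree_def)
  have ab: "a \<rightarrow>\<^bsub>T\<^esub> b"
    using p by (auto simp: vpath_def vwalk_def)
  have "c = b" if ac: "a \<rightarrow>\<^bsub>T\<^esub> c" for c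
  proof (rule ccontr)
    assume "c \<noteq> b"
    then have "c \<notin> set (a # b # ps)"
      using ac sgraph_tree_vpath_adj_hd[OF T p] adj_not_same by auto
    moreover have "vwalk (c # a # b # ps) T"
      using p ac adj_sym[of a c] vwalk_wf_digraph_consI[of "a # b # ps" c]
      by (simp add: vpath_def)
    ultimately have "vpath (c # a # b # ps) T"
      using p by (auto simp: vpath_def)
    from longest[OF this] show False by simp
  qed
  then show ?thesis using ab unfolding set_eq_iff in_nbhd_iff singleton_iff by metis
qed

lemma ex_leaf_with_end_support:
  assumes T: "sgraph_tree T" and n: "2 \<le> card (verts T)"
  obtains v x y where "nbhd T v = {x}" "\<And>w. w \<in> nbhd T x \<Longrightarrow> w \<noteq> y \<Longrightarrow> leaf T w"
proof -
  interpret graph T using T by (simp add: sgraph_tree_def)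
  have con: "connected T" using T by (simp add: sgraph_tree_def)
  obtain r where r: "r \<in> verts T" using n by (cases "verts T = {}") auto
  obtain s where rs: "r \<rightarrow>\<^bsub>T\<^esub> s"
    using connected_imp_nbhd_nonempty[OF con n r] by (auto simp: in_nbhd_iff)
  have rsp: "vpath [r, s] T"
    using rs by (rule vpathI_arc)
  have bound: "length q \<le> card (verts T)" if "vpath q T" for q
  proof -
    have "length q = card (set q)" using that by (simp add: vpath_def distinct_card)
    also have "\<dots> \<le> card (verts T)"
      using that by (intro card_mono) (auto simp: vpath_def vwalk_def)
    finally show ?thesis .
  qed
  \<comment> \<open>A longest path exists because path lengths are bounded by the order; the maximum
    principle asks for a strict bound, hence the \<open>Suc\<close>.\<close>
  obtain p where p: "vpath p T" and longest: "\<And>q. vpath q T \<Longrightarrow> length q \<le> length p"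
    using ex_has_greatest_nat[of "\<lambda>q. vpath q T" "[r, s]" length "Suc (card (verts T))"] rsp bound
    by (metis le_imp_less_Suc)
  have "length p \<ge> 2" using longest[OF rsp] by simp
  then obtain v x ps where pv: "p = v # x # ps"
    by (metis Suc_le_length_iff numeral_2_eq_2)
  have v: "nbhd T v = {x}"
    using longest_vpath_hd_nbhd[OF T] p longest unfolding pv by blast
  \<comment> \<open>The exceptional neighbour of \<open>x\<close> is the third vertex of the path. A
    path of two vertices has none, and \<open>v\<close> is then a default value.\<close>
  define y where "y = (if ps = [] then v else hd ps)"
  have "leaf T w" if w: "w \<in> nbhd T x" "w \<noteq> y" for w
  proof (cases "w = v")
    case True
    then show ?thesis using v leaf_iff by blast
  next
    case False
    have xw: "x \<rightarrow>\<^bsub>T\<^esub> w" using w in_nbhd_iff by blast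
    have xps: "vpath (x # ps) T"
      using p vwalkI_append_r[of "x # ps" "[v]" T] by (auto simp: pv vpath_def)
    have "w \<notin> set ps"
    proof (cases ps)
      case (Cons z zs)
      then show ?thesis
        using sgraph_tree_vpath_adj_hd[OF T, of x z zs] xps xw w by (auto simp: y_def)
    qed simp
    moreover have "vwalk (w # x # ps) T"
      using xps xw adj_sym[of x w] vwalk_wf_digraph_consI[of "x # ps" w]
      by (simp add: vpath_def)
    ultimately have "vpath (w # x # ps) T"
      using xps xw adj_not_same by (auto simp: vpath_def)
    \<comment> \<open>Exchanging the end \<open>v\<close> for \<open>w\<close> keeps the length, so
      \<open>w\<close> is also the end of a longest path.\<close>
    then have "nbhd T w = {x}"
      using longest by (intro longest_vpath_hd_nbhd[OF T]) (auto simp: pv)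
    then show ?thesis using leaf_iff by blast
  qed
  with v show thesis by (rule that)
qed

text \<open>Two common neighbours would give the 4-cycle \<open>x\<close>, \<open>a\<close>,
  \<open>y\<close>, \<open>b\<close>.\<close>

lemma sgraph_tree_common_nbhd:
  assumes T: "sgraph_tree T" and xy: "x \<noteq> y"
    and a: "a \<in> nbhd T x" "a \<in> nbhd T y" and b: "b \<in> nbhd T x" "b \<in> nbhd T y"
  shows "a = b"
proof (rule ccontr)
  interpret graph T using T by (simp add: sgraph_tree_def)
  assume ab: "a \<noteq> b"
  have adj: "x \<rightarrow>\<^bsub>T\<^esub> a" "a \<rightarrow>\<^bsub>T\<^esub> y" "y \<rightarrow>\<^bsub>T\<^esub> b" "b \<rightarrow>\<^bsub>T\<^esub> x"
    using a b by (auto simp: in_nbhd_iff adj_sym)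
  then have "vpath [x, a, y, b] T"
    using ab xy by (auto simp: vpath_def vwalk_def dest: adj_in_verts adj_not_same)
  from sgraph_tree_vpath_not_closed[OF T this] adj show False by simp
qed

lemma sgraph_tree_adj_no_common_nbhd:
  assumes T: "sgraph_tree T" and xy: "y \<in> nbhd T x" and a: "a \<in> nbhd T x"
  shows "a \<notin> nbhd T y"
proof
  interpret graph T using T by (simp add: sgraph_tree_def)
  assume "a \<in> nbhd T y"
  then have adj: "x \<rightarrow>\<^bsub>T\<^esub> y" "y \<rightarrow>\<^bsub>T\<^esub> a" "a \<rightarrow>\<^bsub>T\<^esub> x"
    using xy a by (auto simp: in_nbhd_iff adj_sym)
  then have "vpath [x, y, a] T"
    by (auto simp: vpath_def vwalk_def dest: adj_in_verts adj_not_same)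
  from sgraph_tree_vpath_not_closed[OF T this] adj show False by simp
qed

section \<open>Redundant locating-dominating sets\<close>

lemma LD_set_dominating:
  "LD_set G S \<Longrightarrow> v \<in> verts G \<Longrightarrow> v \<notin> S \<Longrightarrow> nbhd G v \<inter> S \<noteq> {}"
  by (metis DiffI LD_set_def)

lemma LD_set_separating:
  "LD_set G S \<Longrightarrow> u \<in> verts G - S \<Longrightarrow> v \<in> verts G - S \<Longrightarrow> u \<noteq> v \<Longrightarrow>
    nbhd G v \<inter> S \<noteq> nbhd G u \<inter> S"
  by (metis LD_set_def)

text \<open>Intersecting with the larger set keeps every dominating neighbour and every neighbour
  that tells two vertices apart, while fewer vertices remain outside.\<close>

lemma LD_set_mono:
  assumes "LD_set G S" "S \<subseteq> S'" "S' \<subseteq> verts G"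
  shows "LD_set G S'"
  unfolding LD_set_def
proof (intro conjI ballI impI)
  fix u v assume *: "u \<in> verts G - S'" "v \<in> verts G - S'"
  then show "nbhd G v \<inter> S' \<noteq> {}"
    using LD_set_dominating[OF assms(1), of v] assms(2) by blast
  assume "u \<noteq> v"
  with * assms(2) have "nbhd G v \<inter> S \<noteq> nbhd G u \<inter> S"
    using LD_set_separating[OF assms(1), of u v] by blast
  with assms(2) show "nbhd G v \<inter> S' \<noteq> nbhd G u \<inter> S'" by blast
qed (fact assms(3))

lemma RED_LD_set_mono:
  assumes S: "RED_LD_set G S" "S \<subseteq> S'" "S' \<subseteq> verts G"
  shows "RED_LD_set G S'"
  unfolding RED_LD_set_def
proof (intro conjI ballI)
  show "LD_set G S'"
    using S LD_set_mono by (auto simp: RED_LD_set_def)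
  fix v assume "v \<in> S'"
  show "LD_set G (S' - {v})"
  proof (cases "v \<in> S")
    case True
    with S(1) have "LD_set G (S - {v})" by (simp add: RED_LD_set_def)
    then show ?thesis using S by (elim LD_set_mono) auto
  next
    case False
    from S(1) have "LD_set G S" by (simp add: RED_LD_set_def)
    then show ?thesis using S False by (elim LD_set_mono) auto
  qed
qed

section \<open>RED:LD sets that omit at most one vertex\<close>

lemma RED_LD_set_verts:
  assumes "graph G" and iso: "\<And>v. v \<in> verts G \<Longrightarrow> nbhd G v \<noteq> {}"
  shows "RED_LD_set G (verts G)"
proof -
  interpret graph G by fact
  have "nbhd G v \<inter> (verts G - {v}) \<noteq> {}" if "v \<in> verts G" for v
    using iso[OF that] not_in_nbhd_self[of v] by (auto simp: nbhd_def)
  then show ?thesis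
    by (auto simp: RED_LD_set_def LD_set_def)
qed

text \<open>By monotonicity, a RED:LD set other than the whole vertex set can be enlarged to one
  that misses a single vertex. If there is none of that kind, the whole vertex set is the only
  candidate for the minimum.\<close>

lemma RED_LD_eq_card_iff:
  assumes G: "graph G" and iso: "\<And>v. v \<in> verts G \<Longrightarrow> nbhd G v \<noteq> {}"
  shows "RED_LD G = card (verts G) \<longleftrightarrow> (\<forall>x\<in>verts G. \<not> RED_LD_set G (verts G - {x}))"
proof -
  interpret graph G by fact
  have sub: "S \<subseteq> verts G" if "RED_LD_set G S" for S
    using that by (auto simp: RED_LD_set_def LD_set_def)
  show ?thesis
  proof (intro iffI ballI notI)
    fix x assume *: "RED_LD G = card (verts G)" "x \<in> verts G" "RED_LD_set G (verts G - {x})"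
    then have "RED_LD G \<le> card (verts G - {x})"
      unfolding RED_LD_def by (intro Least_le) blast
    with * show False
      by (metis card_Diff1_less finite_verts leD)
  next
    assume *: "\<forall>x\<in>verts G. \<not> RED_LD_set G (verts G - {x})"
    have "S = verts G" if S: "RED_LD_set G S" for S
    proof (rule ccontr)
      assume "S \<noteq> verts G"
      with sub[OF S] obtain x where "x \<in> verts G" "S \<subseteq> verts G - {x}" by blast
      with * RED_LD_set_mono[OF S] show False by blast
    qed
    with RED_LD_set_verts[OF G iso] have "RED_LD_set G S \<longleftrightarrow> S = verts G" for S by metis
    then show "RED_LD G = card (verts G)"
      unfolding RED_LD_def by (simp add: Least_equality)
  qed
qed

text \<open>After a second vertex \<open>y\<close> is removed, only \<open>x\<close> and
  \<open>y\<close> lie outside the set. Domination fails when one of them is a leaf whose sole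
  neighbour is the other, or when \<open>y\<close> is the sole neighbour of \<open>x\<close>.
  Separation never fails once \<open>x\<close> has two neighbours, since a tree has no triangle and
  no 4-cycle.\<close>

lemma RED_LD_set_minus_singleton_iff:
  assumes T: "sgraph_tree T" and n: "2 \<le> card (verts T)" and x: "x \<in> verts T"
  shows "RED_LD_set T (verts T - {x}) \<longleftrightarrow> \<not> leaf T x \<and> (\<forall>y\<in>nbhd T x. \<not> leaf T y)"
proof -
  interpret graph T using T by (simp add: sgraph_tree_def)
  have ne: "nbhd T v \<noteq> {}" if "v \<in> verts T" for v
    using T n that connected_imp_nbhd_nonempty by (simp add: sgraph_tree_def)
  have sub: "nbhd T v \<subseteq> verts T" for v by (auto simp: nbhd_def)
  show ?thesis
  proof (intro iffI conjI ballI notI)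
    assume R: "RED_LD_set T (verts T - {x})" and "leaf T x"
    then obtain u where u: "nbhd T x = {u}" using leaf_iff by blast
    then have "u \<in> verts T - {x}" using sub not_in_nbhd_self by blast
    with R have "LD_set T (verts T - {x} - {u})" by (simp add: RED_LD_set_def)
    from LD_set_dominating[OF this x] u show False by simp
  next
    fix y assume R: "RED_LD_set T (verts T - {x})" and y: "y \<in> nbhd T x" "leaf T y"
    then have "nbhd T y = {x}" using leaf_iff nbhd_sym by auto
    moreover have yV: "y \<in> verts T - {x}" using y sub not_in_nbhd_self by blast
    with R have "LD_set T (verts T - {x} - {y})" by (simp add: RED_LD_set_def)
    from LD_set_dominating[OF this, of y] yV have "nbhd T y \<inter> (verts T - {x} - {y}) \<noteq> {}" by simp
    ultimately show False by simp
  next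
    assume nl: "\<not> leaf T x \<and> (\<forall>y\<in>nbhd T x. \<not> leaf T y)"
    have two: "\<exists>a\<in>nbhd T v. a \<noteq> u" if "v \<in> verts T" "\<not> leaf T v" for u v
    proof (rule ccontr)
      assume "\<not> ?thesis"
      with ne[OF that(1)] have "nbhd T v = {u}" by auto
      with that(2) show False by (simp add: leaf_iff)
    qed
    have "LD_set T (verts T - {x} - {y})" if y: "y \<in> verts T" "y \<noteq> x" for y
    proof -
      let ?S = "verts T - {x} - {y}"
      have domx: "nbhd T x \<inter> ?S \<noteq> {}"
        using two[OF x, of y] nl sub not_in_nbhd_self by blast
      have domy: "nbhd T y \<inter> ?S \<noteq> {}"
      proof (cases "y \<in> nbhd T x")
        case True
        then show ?thesis using two[OF y(1), of x] nl sub not_in_nbhd_self by blast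
      next
        case False
        then have "x \<notin> nbhd T y" using nbhd_sym by blast
        then show ?thesis using ne[OF y(1)] sub not_in_nbhd_self by blast
      qed
      have neq: "nbhd T x \<inter> ?S \<noteq> nbhd T y \<inter> ?S"
      proof
        assume eq: "nbhd T x \<inter> ?S = nbhd T y \<inter> ?S"
        obtain a where a: "a \<in> nbhd T x" "a \<in> nbhd T y" using domx eq by blast
        \<comment> \<open>Without a triangle \<open>x\<close> and \<open>y\<close> are not adjacent,
          so every neighbour of \<open>x\<close> stays in \<open>?S\<close>. A second neighbour
          \<open>b\<close> of \<open>x\<close> is then shared with \<open>y\<close> as well, which
          contradicts uniqueness of the common neighbour.\<close>
        then have yx: "y \<notin> nbhd T x" using sgraph_tree_adj_no_common_nbhd[OF T] by blast
        obtain b where b: "b \<in> nbhd T x" "b \<noteq> a" using two[OF x] nl by blast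
        then have "b \<in> nbhd T x \<inter> ?S" using yx sub not_in_nbhd_self by blast
        then have "b \<in> nbhd T y" using eq by blast
        with sgraph_tree_common_nbhd[OF T, of x y a b] a b y show False by blast
      qed
      have "verts T - ?S = {x, y}" using x y by blast
      with domx domy neq show ?thesis
        unfolding LD_set_def by auto
    qed
    moreover have "LD_set T (verts T - {x})"
      using x ne[OF x] not_in_nbhd_self sub by (fastforce simp: LD_set_def)
    ultimately show "RED_LD_set T (verts T - {x})"
      by (auto simp: RED_LD_set_def)
  qed
qed

lemma T_max_iff:
  "T \<in> T_max \<longleftrightarrow> sgraph_tree T \<and> 2 \<le> card (verts T) \<and>
     (\<forall>x\<in>verts T. leaf T x \<or> (\<exists>y\<in>nbhd T x. leaf T y))"
proof (cases "sgraph_tree T \<and> 2 \<le> card (verts T)")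
  case True
  then interpret graph T by (simp add: sgraph_tree_def)
  have "nbhd T v \<noteq> {}" if "v \<in> verts T" for v
    using True that connected_imp_nbhd_nonempty by (simp add: sgraph_tree_def)
  with True have "RED_LD T = card (verts T) \<longleftrightarrow> (\<forall>x\<in>verts T. \<not> RED_LD_set T (verts T - {x}))"
    by (intro RED_LD_eq_card_iff) (auto simp: sgraph_tree_def)
  with True show ?thesis
    by (auto simp: T_max_def RED_LD_set_minus_singleton_iff)
qed (auto simp: T_max_def)

section \<open>Deleting the end leaf of a longest path\<close>

theorem theorem12:
  fixes T :: "('a, 'b) pre_digraph"
  assumes "T \<in> T_max"
    and "3 \<le> card (verts T)"
  shows "\<exists>v \<in> verts T. leaf T v \<and> pre_digraph.del_vert T v \<in> T_max"
proof -
  have T: "sgraph_tree T" and n: "2 \<le> card (verts T)"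
    and cover: "\<And>x. x \<in> verts T \<Longrightarrow> leaf T x \<or> (\<exists>y\<in>nbhd T x. leaf T y)"
    using assms(1) by (auto simp: T_max_iff)
  interpret graph T using T by (simp add: sgraph_tree_def)
  obtain v x y where v: "nbhd T v = {x}"
    and leaves: "\<And>w. w \<in> nbhd T x \<Longrightarrow> w \<noteq> y \<Longrightarrow> leaf T w"
    using ex_leaf_with_end_support[OF T n] by metis
  have leaf_v: "leaf T v" using v leaf_iff by blast
  then have vV: "v \<in> verts T" by (simp add: leaf_def)
  have xv: "x \<noteq> v" using v not_in_nbhd_self by blast
  have v_nbhd: "v \<in> nbhd T w \<longleftrightarrow> w = x" for w using v nbhd_sym by auto
  interpret D: graph "del_vert v" by (rule graph_del_vert)
  have tree: "sgraph_tree (del_vert v)"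
    using T leaf_v by (rule sgraph_tree_del_leaf)
  have card: "2 \<le> card (verts (del_vert v))"
    using assms(2) vV by (simp add: del_vert_simps)
  \<comment> \<open>Only the neighbourhood of \<open>x\<close> contains \<open>v\<close>, so every
    other remaining vertex keeps its neighbourhood.\<close>
  have stays_leaf: "leaf (del_vert v) w" if "leaf T w" "w \<noteq> v" "w \<noteq> x" for w
    using that v_nbhd unfolding D.leaf_iff leaf_iff by (simp add: nbhd_del_vert)
  have "leaf (del_vert v) z \<or> (\<exists>u\<in>nbhd (del_vert v) z. leaf (del_vert v) u)"
    if z: "z \<in> verts (del_vert v)" for z
  proof (cases "z = x")
    case True
    have nb: "nbhd (del_vert v) x = nbhd T x - {v}" using xv by (rule nbhd_del_vert)
    show ?thesis
    proof (cases "\<exists>w\<in>nbhd T x - {v}. leaf T w")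
      case True
      then obtain w where w: "w \<in> nbhd T x - {v}" "leaf T w" by blast
      then have "w \<noteq> x" using not_in_nbhd_self by blast
      with w stays_leaf nb \<open>z = x\<close> show ?thesis by blast
    next
      case False
      \<comment> \<open>If no leaf is left next to \<open>x\<close>, only the exceptional
        \<open>y\<close> can remain; connectedness of the smaller tree forces it to be there, and
        \<open>x\<close> has become a leaf.\<close>
      then have "nbhd (del_vert v) x \<subseteq> {y}" using leaves nb by blast
      moreover have "nbhd (del_vert v) x \<noteq> {}"
        using tree card z \<open>z = x\<close> D.connected_imp_nbhd_nonempty by (simp add: sgraph_tree_def)
      ultimately have "leaf (del_vert v) x" unfolding D.leaf_iff by blast
      with \<open>z = x\<close> show ?thesis by blast
    qed
  next
    case zx: False
    have zv: "z \<in> verts T" "z \<noteq> v" using z by (auto simp: del_vert_simps)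
    show ?thesis
    proof (cases "leaf T z")
      case True
      then show ?thesis using stays_leaf zv zx by blast
    next
      case False
      then obtain u where u: "u \<in> nbhd T z" "leaf T u" using cover zv by blast
      have "u \<noteq> v" using u v_nbhd zx by blast
      have "u \<in> nbhd (del_vert v) z" using u \<open>u \<noteq> v\<close> zv by (simp add: nbhd_del_vert)
      moreover have "leaf (del_vert v) u"
      proof -
        have "v \<in> nbhd T x" using v_nbhd by blast
        \<comment> \<open>If the leaf \<open>u\<close> were \<open>x\<close>, it would have the two
          distinct neighbours \<open>v\<close> and \<open>z\<close>.\<close>
        then have "u \<noteq> x" using u zv(2) nbhd_sym[of u z] by (auto simp: leaf_iff)
        with u \<open>u \<noteq> v\<close> show ?thesis using stays_leaf by blast
      qed
      ultimately show ?thesis by blast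
    qed
  qed
  with tree card have "del_vert v \<in> T_max" by (simp add: T_max_iff)
  with leaf_v vV show ?thesis by blast
qed

end
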